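(* Let $W\in\mathcal{DT}$ be an operator of diagonal type on $L^2(\mathbb T)$ with matrix $(W_{j,k})_{j,k\in\mathbb Z}$. For $a\in\mathbb T$ let $$w_l(a)=\sum_{j\in\mathbb Z}W_{l,j}e^{i(l-j)a}\quad(l\in\mathbb Z),\qquad \rho(L_a)=\limsup_{\#I\to\infty}\frac1{\#I}\sum_{l\in I}|w_l(a)|^2,$$ where $I$ ranges over finite integer intervals. Then $a\mapsto\rho(L_a)$ is a continuous function on $\mathbb T$.
   Context: $\mathbb T=\mathbb R/(2\pi\mathbb Z)$ with measure $\frac1{2\pi}dx$. An operator $W$ on $L^2(\mathbb T)$ is described by its matrix $(W_{j,k})_{j,k\in\mathbb Z}$ in the basis $e^{ikx}$: if $f=\sum_kf_ke^{ikx}$ then $Wf=\sum_{j}\big(\sum_kW_{j,k}f_k\big)e^{ijx}$. Put $c_k=\sup_{j\in\mathbb Z}|W_{k+j,j}|$. $W$ is of diagonal type, $W\in\mathcal{DT}$, if $\sum_{k\in\mathbb Z}c_k<\infty$. Here $L_a$ denotes the distribution $L_a(x)=\sum_{l\in\mathbb Z}w_l(a)e^{ilx}$. An integer interval is a set $I=\{n,n+1,\dots,m\}\subset\mathbb Z$, $\#I=m-n+1$, and $\limsup_{\#I\to\infty}$ means $\lim_{N\to\infty}\sup_{\#I\ge N}$. *)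

theory Defs
  imports "HOL-Analysis.Analysis"
begin

text \<open>
  The circle \<open>\<real> / 2\<pi>\<int>\<close> with the measure \<open>dx / 2\<pi>\<close>, realised on the fundamental
  domain \<open>[0, 2\<pi>)\<close>.  Elements of \<open>L\<^sup>2\<close> are represented by square integrable functions; they are
  only ever compared through integrals, i.e. up to null sets.
\<close>

definition circle_measure :: "real measure" where
  "circle_measure = scale_measure (ennreal (1 / (2 * pi))) (restrict_space lborel {0..<2 * pi})"

definition L2_circle :: "(real \<Rightarrow> complex) set" where
  "L2_circle = {f \<in> borel_measurable circle_measure.
     integrable circle_measure (\<lambda>x. (cmod (f x))\<^sup>2)}"

text \<open>\<open>has_fourier_series f c\<close>: \<open>f = (\<Sum>k. c k * exp(i k x))\<close>, the (unconditional) convergence being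
  that of the Hilbert space \<open>L\<^sup>2\<close>.\<close>

definition has_fourier_series :: "(real \<Rightarrow> complex) \<Rightarrow> (int \<Rightarrow> complex) \<Rightarrow> bool" where
  "has_fourier_series f c \<longleftrightarrow> f \<in> L2_circle \<and>
     ((\<lambda>K. \<integral>x. (cmod (f x - (\<Sum>k\<in>K. c k * cis (of_int k * x))))\<^sup>2 \<partial>circle_measure)
        \<longlongrightarrow> 0) (finite_subsets_at_top UNIV)"

text \<open>\<open>T\<close> is an operator on \<open>L\<^sup>2\<close> with matrix \<open>W\<close> in the basis \<open>exp(i k x)\<close>.  Linearity of \<open>T\<close> and
  independence of the representative, both up to null sets, follow from this description.\<close>

definition has_matrix ::
    "((real \<Rightarrow> complex) \<Rightarrow> (real \<Rightarrow> complex)) \<Rightarrow> (int \<Rightarrow> int \<Rightarrow> complex) \<Rightarrow> bool" where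
  "has_matrix T W \<longleftrightarrow> (\<forall>f \<in> L2_circle. T f \<in> L2_circle) \<and>
     (\<forall>f c. has_fourier_series f c \<longrightarrow>
        (\<forall>j. (\<lambda>k. W j k * c k) summable_on UNIV) \<and>
        has_fourier_series (T f) (\<lambda>j. \<Sum>\<^sub>\<infinity>k. W j k * c k))"

definition diag_sup :: "(int \<Rightarrow> int \<Rightarrow> complex) \<Rightarrow> int \<Rightarrow> real" where
  "diag_sup W k = (SUP j. cmod (W (k + j) j))"

text \<open>The boundedness condition says that the suprema \<open>diag_sup W k\<close> are finite; a real \<open>SUP\<close> of an
  unbounded set would be meaningless.\<close>

definition diagonal_type :: "(int \<Rightarrow> int \<Rightarrow> complex) \<Rightarrow> bool" where
  "diagonal_type W \<longleftrightarrow> (\<forall>k. bdd_above (range (\<lambda>j. cmod (W (k + j) j)))) \<and>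
     diag_sup W summable_on UNIV"

definition L_coeff :: "(int \<Rightarrow> int \<Rightarrow> complex) \<Rightarrow> real \<Rightarrow> int \<Rightarrow> complex" where
  "L_coeff W a l = (\<Sum>\<^sub>\<infinity>j. W l j * cis (of_int (l - j) * a))"

definition int_interval :: "int set \<Rightarrow> bool" where
  "int_interval I \<longleftrightarrow> (\<exists>n m. n \<le> m \<and> I = {n..m})"

text \<open>The quantity \<open>\<rho>\<close> of the distribution with Fourier coefficients \<open>w\<close>; it lies in \<open>[0, \<infinity>]\<close>.\<close>

definition rho :: "(int \<Rightarrow> complex) \<Rightarrow> ereal" where
  "rho w = lim (\<lambda>N::nat. SUP I\<in>{I. int_interval I \<and> card I \<ge> N}.
     ereal ((1 / real (card I)) * (\<Sum>l\<in>I. (cmod (w l))\<^sup>2)))"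

end

theory Submission
  imports Defs
begin

text \<open>
  Re-indexed along diagonals, \<open>L_coeff W a l\<close> is the sum over \<open>k\<close> of terms \<open>W l (l - k) e^(i k a)\<close> of
  modulus at most \<open>diag_sup W k\<close>.  So the coefficients are bounded, and \<open>a \<mapsto> L_coeff W a l\<close> has a
  modulus of continuity independent of \<open>l\<close>.  As \<open>rho\<close> is monotone in the squared moduli and a
  constant added to all of them raises \<open>rho\<close> by at most that constant, this passes to
  \<open>a \<mapsto> rho (L_coeff W a)\<close>.
\<close>

section \<open>Comparison and finiteness of \<open>rho\<close>\<close>

definition interval_mean :: "(int \<Rightarrow> complex) \<Rightarrow> int set \<Rightarrow> real" where
  "interval_mean w I = (1 / real (card I)) * (\<Sum>l\<in>I. (cmod (w l))\<^sup>2)"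

definition rho_sup :: "(int \<Rightarrow> complex) \<Rightarrow> nat \<Rightarrow> ereal" where
  "rho_sup w N = (SUP I\<in>{I. int_interval I \<and> card I \<ge> N}. ereal (interval_mean w I))"

lemma int_interval_card_pos: "int_interval I \<Longrightarrow> card I > 0"
  by (auto simp: int_interval_def)

text \<open>Keeps the families in \<open>rho_sup\<close> nonempty; an empty supremum in
  \<open>ereal\<close> would be minus infinity.\<close>

lemma int_interval_exists: "\<exists>I. int_interval I \<and> card I \<ge> N"
  by (rule exI[of _ "{0..int N}"]) (auto simp: int_interval_def)

lemma interval_mean_nonneg: "interval_mean w I \<ge> 0"
  by (simp add: interval_mean_def sum_nonneg)

lemma interval_mean_le_add:
  assumes "int_interval I" and "\<And>l. (cmod (u l))\<^sup>2 \<le> (cmod (v l))\<^sup>2 + e"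
  shows "interval_mean u I \<le> interval_mean v I + e"
proof -
  have "(\<Sum>l\<in>I. (cmod (u l))\<^sup>2) \<le> (\<Sum>l\<in>I. (cmod (v l))\<^sup>2 + e)"
    using assms(2) by (intro sum_mono)
  also have "\<dots> = (\<Sum>l\<in>I. (cmod (v l))\<^sup>2) + real (card I) * e"
    by (simp add: sum.distrib)
  finally show ?thesis
    using int_interval_card_pos[OF assms(1)] by (simp add: interval_mean_def field_simps)
qed

lemma rho_sup_nonneg: "rho_sup w N \<ge> 0"
proof -
  obtain I where "int_interval I" "card I \<ge> N"
    using int_interval_exists by blast
  then show ?thesis
    unfolding rho_sup_def by (intro SUP_upper2[of I]) (auto simp: interval_mean_nonneg)
qed

text \<open>Raising \<open>N\<close> shrinks the family of intervals, so the suprema decrease and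
  converge to their infimum. Hence the \<open>lim\<close> in \<open>rho\<close> is a genuine
  limit.\<close>

lemma rho_eq_INF: "rho w = (INF N. rho_sup w N)"
proof -
  have "decseq (rho_sup w)"
    unfolding decseq_def rho_sup_def by (auto intro!: SUP_subset_mono)
  then have "lim (rho_sup w) = (INF N. rho_sup w N)"
    by (intro limI LIMSEQ_INF)
  moreover have "rho w = lim (rho_sup w)"
    by (simp add: rho_def rho_sup_def[abs_def] interval_mean_def)
  ultimately show ?thesis
    by simp
qed

lemma rho_nonneg: "rho w \<ge> 0"
  by (auto simp: rho_eq_INF intro!: INF_greatest rho_sup_nonneg)

lemma rho_le_add:
  assumes "\<And>l. (cmod (u l))\<^sup>2 \<le> (cmod (v l))\<^sup>2 + e"
  shows "rho u \<le> rho v + ereal e"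
proof -
  have "rho_sup u N \<le> rho_sup v N + ereal e" for N
    unfolding rho_sup_def
  proof (rule SUP_least)
    fix I assume I: "I \<in> {I. int_interval I \<and> N \<le> card I}"
    then have "ereal (interval_mean u I) \<le> ereal (interval_mean v I) + ereal e"
      using interval_mean_le_add[OF _ assms] by auto
    also have "\<dots> \<le> (SUP I\<in>{I. int_interval I \<and> N \<le> card I}. ereal (interval_mean v I)) + ereal e"
      using I by (intro add_right_mono SUP_upper)
    finally show "ereal (interval_mean u I) \<le> \<dots>" .
  qed
  then have "(INF N. rho_sup u N) \<le> (INF N. rho_sup v N + ereal e)"
    by (intro INF_mono) auto
  \<comment> \<open>The finite constant can leave the infimum in \<open>ereal\<close> because the
    terms are nonnegative.\<close>
  also have "\<dots> = (INF N. rho_sup v N) + ereal e"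
    by (intro INF_ereal_add_left) (auto simp: rho_sup_nonneg)
  finally show ?thesis
    by (simp add: rho_eq_INF)
qed

lemma rho_zero: "rho (\<lambda>_. 0) = 0"
proof -
  have "rho_sup (\<lambda>_. 0) N = 0" for N
    using int_interval_exists[of N] by (auto simp: rho_sup_def interval_mean_def)
  then show ?thesis
    by (simp add: rho_eq_INF)
qed

text \<open>Comparison with the zero sequence, with \<open>C\<^sup>2\<close> as the added constant,
  bounds \<open>rho w\<close> above.\<close>

lemma rho_finite:
  assumes "\<And>l. cmod (w l) \<le> C"
  shows "\<bar>rho w\<bar> \<noteq> \<infinity>"
proof -
  have "(cmod (w l))\<^sup>2 \<le> C\<^sup>2" for l
    using assms by (intro power_mono) auto
  then have "rho w \<le> ereal (C\<^sup>2)"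
    using rho_le_add[of w "\<lambda>_. 0" "C\<^sup>2"] by (simp add: rho_zero)
  then show ?thesis
    using rho_nonneg[of w] by auto
qed

text \<open>Factor the difference of squared moduli: the sum of the moduli is at most
  \<open>2 * C\<close>, their difference at most \<open>d\<close>. Then apply
  \<open>rho_le_add\<close> in both directions.\<close>

lemma rho_dist_le:
  assumes u: "\<And>l. cmod (u l) \<le> C" and v: "\<And>l. cmod (v l) \<le> C"
    and uv: "\<And>l. cmod (u l - v l) \<le> d"
  shows "\<bar>real_of_ereal (rho u) - real_of_ereal (rho v)\<bar> \<le> 2 * C * d"
proof -
  have one_sided: "real_of_ereal (rho f) \<le> real_of_ereal (rho g) + 2 * C * d"
    if f: "\<And>l. cmod (f l) \<le> C" and g: "\<And>l. cmod (g l) \<le> C"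
      and fg: "\<And>l. cmod (f l - g l) \<le> d" for f g
  proof -
    have "(cmod (f l))\<^sup>2 \<le> (cmod (g l))\<^sup>2 + 2 * C * d" for l
    proof -
      have "cmod (f l) - cmod (g l) \<le> d"
        using norm_triangle_ineq2[of "f l" "g l"] fg[of l] by linarith
      \<comment> \<open>The sign of \<open>d\<close> is needed to replace the factor
        \<open>cmod (f l) + cmod (g l)\<close> by \<open>2 * C\<close>.\<close>
      moreover have "0 \<le> d"
        using norm_ge_zero fg[of l] by (rule order_trans)
      ultimately have "(cmod (f l) + cmod (g l)) * (cmod (f l) - cmod (g l)) \<le> (2 * C) * d"
        by (smt (verit) f g mult_left_mono mult_right_mono norm_ge_zero)
      then show ?thesis
        by (simp add: power2_eq_square algebra_simps)
    qed
    then have "rho f \<le> rho g + ereal (2 * C * d)"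
      by (rule rho_le_add)
    \<comment> \<open>Both values are finite, so the inequality survives
      \<open>real_of_ereal\<close>, which would send infinities to 0.\<close>
    then show ?thesis
      using rho_finite[of f, OF f] rho_finite[of g, OF g] by (cases "rho f"; cases "rho g") auto
  qed
  have vu: "cmod (v l - u l) \<le> d" for l
    using uv[of l] by (simp add: norm_minus_commute)
  show ?thesis
    using one_sided[of u v, OF u v uv] one_sided[of v u, OF v u vu] by linarith
qed

section \<open>Summation along diagonals\<close>

lemma norm_le_diag_sup:
  assumes "diagonal_type W"
  shows "cmod (W l (l - k)) \<le> diag_sup W k"
  using assms cSUP_upper[of "l - k" UNIV "\<lambda>j. cmod (W (k + j) j)"]
  by (simp add: diagonal_type_def diag_sup_def)

text \<open>The substitution \<open>j = l - k\<close> is its own inverse. It makes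
  \<open>diag_sup W\<close> a majorant for every row \<open>l\<close> at once.\<close>

lemma L_coeff_eq_diagonal_sum:
  "L_coeff W a l = (\<Sum>\<^sub>\<infinity>k. W l (l - k) * cis (of_int k * a))"
proof -
  have "bij (\<lambda>k. l - k)"
    by (rule o_bij[of "\<lambda>k. l - k"]) auto
  from infsum_reindex_bij_betw[OF this, of "\<lambda>j. W l j * cis (of_int (l - j) * a)"]
  show ?thesis
    by (simp add: L_coeff_def)
qed

lemma L_coeff_periodic: "L_coeff W (a + 2 * pi) = L_coeff W a"
proof -
  have "cis (of_int k * (a + 2 * pi)) = cis (of_int k * a)" for k :: int
    using cis_multiple_2pi[of "of_int k"] by (simp add: distrib_left mult_ac flip: cis_mult)
  then show ?thesis
    by (simp add: L_coeff_def fun_eq_iff flip: of_int_diff)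
qed

lemma diagonal_summable:
  assumes "diagonal_type W"
  shows "(\<lambda>k. W l (l - k) * cis (of_int k * a)) summable_on UNIV"
proof -
  have "(\<lambda>k. norm (W l (l - k) * cis (of_int k * a))) summable_on UNIV"
    by (rule Infinite_Sum.abs_summable_on_comparison_test'[of "diag_sup W"])
      (use assms in \<open>auto simp: norm_mult norm_le_diag_sup diagonal_type_def\<close>)
  then show ?thesis
    by (rule abs_summable_summable)
qed

lemma norm_L_coeff_le:
  assumes "diagonal_type W"
  shows "cmod (L_coeff W a l) \<le> (\<Sum>\<^sub>\<infinity>k. diag_sup W k)"
  unfolding L_coeff_eq_diagonal_sum
  by (rule norm_infsum_le[OF has_sum_infsum has_sum_infsum])
    (use assms in \<open>auto simp: diagonal_summable norm_mult norm_le_diag_sup diagonal_type_def\<close>)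

text \<open>A common modulus of continuity for all coefficients: it involves neither
  \<open>l\<close> nor the base point, and vanishes at \<open>t = 0\<close>.\<close>

definition diag_modulus :: "(int \<Rightarrow> int \<Rightarrow> complex) \<Rightarrow> real \<Rightarrow> real" where
  "diag_modulus W t = (\<Sum>\<^sub>\<infinity>k. diag_sup W k * cmod (cis (of_int k * t) - 1))"

lemma diag_modulus_term_le:
  assumes "diagonal_type W"
  shows "norm (diag_sup W k * cmod (cis (of_int k * t) - 1)) \<le> diag_sup W k * 2"
proof -
  have "0 \<le> diag_sup W k"
    using norm_ge_zero norm_le_diag_sup[OF assms] by (rule order_trans)
  moreover have "cmod (cis (of_int k * t) - 1) \<le> 2"
    using norm_triangle_ineq4[of "cis (of_int k * t)" 1] by simp
  ultimately show ?thesis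
    by (simp add: abs_mult mult_left_mono)
qed

lemma diag_sup_times_2_summable:
  assumes "diagonal_type W"
  shows "(\<lambda>k. diag_sup W k * 2) summable_on UNIV"
  using assms by (intro summable_on_cmult_left) (simp add: diagonal_type_def)

text \<open>Weierstrass M-test along the net of finite index sets, with the majorant
  \<open>diag_sup W k * 2\<close> independent of \<open>t\<close>.\<close>

lemma continuous_diag_modulus:
  assumes "diagonal_type W"
  shows "continuous_on UNIV (diag_modulus W)"
proof -
  have "uniform_limit UNIV (\<lambda>K t. \<Sum>k\<in>K. diag_sup W k * cmod (cis (of_int k * t) - 1))
      (diag_modulus W) (finite_subsets_at_top UNIV)"
    unfolding diag_modulus_def
    by (rule Weierstrass_m_test_general[OF diag_modulus_term_le[OF assms]
          diag_sup_times_2_summable[OF assms]])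
  then show ?thesis
    by (rule uniform_limit_theorem[rotated])
      (auto intro!: always_eventually continuous_intros)
qed

lemma norm_L_coeff_diff_le:
  assumes "diagonal_type W"
  shows "cmod (L_coeff W a l - L_coeff W b l) \<le> diag_modulus W (a - b)"
  unfolding L_coeff_eq_diagonal_sum diag_modulus_def
proof (rule norm_infsum_le)
  show "((\<lambda>k. W l (l - k) * cis (of_int k * a) - W l (l - k) * cis (of_int k * b)) has_sum
      (\<Sum>\<^sub>\<infinity>k. W l (l - k) * cis (of_int k * a)) - (\<Sum>\<^sub>\<infinity>k. W l (l - k) * cis (of_int k * b))) UNIV"
    \<comment> \<open>The instantiations restrict the rewriting to differences of terms and of sums,
      leaving the index \<open>l - k\<close> intact.\<close>
    unfolding diff_conv_add_uminus[of "_ * _"] diff_conv_add_uminus[of "infsum _ _"]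
    by (intro has_sum_add has_sum_uminusI has_sum_infsum diagonal_summable assms)
  show "((\<lambda>k. diag_sup W k * cmod (cis (of_int k * (a - b)) - 1)) has_sum
      (\<Sum>\<^sub>\<infinity>k. diag_sup W k * cmod (cis (of_int k * (a - b)) - 1))) UNIV"
    by (rule has_sum_infsum[OF abs_summable_summable])
      (rule Infinite_Sum.abs_summable_on_comparison_test'[OF diag_sup_times_2_summable[OF assms]
          diag_modulus_term_le[OF assms]])
  fix k
  have "W l (l - k) * cis (of_int k * a) - W l (l - k) * cis (of_int k * b) =
      W l (l - k) * cis (of_int k * b) * (cis (of_int k * (a - b)) - 1)"
    by (simp add: algebra_simps cis_mult)
  then have "cmod (W l (l - k) * cis (of_int k * a) - W l (l - k) * cis (of_int k * b)) =
      cmod (W l (l - k)) * cmod (cis (of_int k * (a - b)) - 1)"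
    by (simp add: norm_mult)
  also have "\<dots> \<le> diag_sup W k * cmod (cis (of_int k * (a - b)) - 1)"
    using norm_le_diag_sup[OF assms] by (intro mult_right_mono) auto
  finally show "cmod (W l (l - k) * cis (of_int k * a) - W l (l - k) * cis (of_int k * b)) \<le> \<dots>" .
qed

text \<open>Finiteness makes \<open>real_of_ereal\<close> lossless, and periodicity lets continuity
  on the line descend to the circle.\<close>

theorem lemma7p4:
  fixes T :: "(real \<Rightarrow> complex) \<Rightarrow> (real \<Rightarrow> complex)"
    and W :: "int \<Rightarrow> int \<Rightarrow> complex"
  assumes "has_matrix T W"
    and "diagonal_type W"
  shows "(\<forall>a. \<bar>rho (L_coeff W a)\<bar> \<noteq> \<infinity>) \<and>
    (\<forall>a. rho (L_coeff W (a + 2 * pi)) = rho (L_coeff W a)) \<and>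
    continuous_on UNIV (\<lambda>a. real_of_ereal (rho (L_coeff W a)))"
proof (intro conjI allI)
  note bound = norm_L_coeff_le[OF assms(2)]
  fix a
  show "\<bar>rho (L_coeff W a)\<bar> \<noteq> \<infinity>"
    by (rule rho_finite[OF bound])
  show "rho (L_coeff W (a + 2 * pi)) = rho (L_coeff W a)"
    by (simp add: L_coeff_periodic)
next
  define C where "C = (\<Sum>\<^sub>\<infinity>k. diag_sup W k)"
  let ?r = "\<lambda>a. real_of_ereal (rho (L_coeff W a))"
  have "(?r \<longlongrightarrow> ?r b) (at b)" for b
  proof (rule Lim_transform_bound[THEN Lim_null[THEN iffD2]])
    show "\<forall>\<^sub>F a in at b. norm (?r a - ?r b) \<le> norm (2 * C * diag_modulus W (a - b))"
    proof (intro always_eventually allI)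
      fix a
      have "\<bar>?r a - ?r b\<bar> \<le> 2 * C * diag_modulus W (a - b)"
        unfolding C_def
        by (intro rho_dist_le norm_L_coeff_le norm_L_coeff_diff_le assms)
      then show "norm (?r a - ?r b) \<le> norm (2 * C * diag_modulus W (a - b))"
        by simp
    qed
    have "isCont (\<lambda>a. 2 * C * diag_modulus W (a - b)) b"
      using continuous_diag_modulus[OF assms(2)]
      by (intro continuous_intros continuous_at_compose[unfolded o_def, of b "\<lambda>a. a - b"])
        (auto simp: continuous_on_eq_continuous_at)
    then show "((\<lambda>a. 2 * C * diag_modulus W (a - b)) \<longlongrightarrow> 0) (at b)"
      \<comment> \<open>At \<open>a = b\<close> every term contains \<open>cis 0 - 1 = 0\<close>, so
        the limit given by continuity is 0.\<close>
      by (simp add: isCont_def diag_modulus_def)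
  qed
  then show "continuous_on UNIV ?r"
    by (simp add: continuous_on_def)
qed

end
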